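(* For all integers $k\ge 1$ and $n\ge 0$, we have $\gamma_{1,4,5,5/2,3/2}^k(n)\ge 0$; that is, the coefficient of $q^n$ in $$\frac{1}{(1-q)(1-q^4)(1-q^5)}\sum_{j\notin[-k,k-1]}(-1)^{j+k}q^{j(5j+3)/2}$$ is nonnegative.
   Context: Identities are between formal power series in $q$. The sum $\sum_{j\notin[-k,k-1]}$ is over all integers $j\le -k-1$ and all integers $j\ge k$. In general $\gamma_{a,b,c,A,B}^k(n)$ is defined by $\frac{1}{(1-q^a)(1-q^b)(1-q^c)}\sum_{j\notin[-k,k-1]}(-1)^{j+k}q^{Aj^2+Bj}=\sum_{n\ge0}\gamma_{a,b,c,A,B}^k(n)q^n$. *)

theory Defs
  imports
    "HOL-Analysis.Infinite_Sum"
    "HOL-Computational_Algebra.Formal_Power_Series"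
begin

(* The exponent A * j^2 + B * j is meant to be a natural number for every integer j, although A and
   B themselves may be half-integers; the floor only serves to turn it into a nat. *)
definition theta_term :: "rat \<Rightarrow> rat \<Rightarrow> int \<Rightarrow> int \<Rightarrow> rat fps" where
  "theta_term A B k j = (- 1) powi (j + k) * fps_X ^ nat \<lfloor>A * of_int j ^ 2 + B * of_int j\<rfloor>"

(* The sum converges in the X-adic topology of the formal power series whenever A > 0: see
   summable_theta_term. *)
definition gamma_fps :: "nat \<Rightarrow> nat \<Rightarrow> nat \<Rightarrow> rat \<Rightarrow> rat \<Rightarrow> int \<Rightarrow> rat fps" where
  "gamma_fps a b c A B k =
     1 / ((1 - fps_X ^ a) * (1 - fps_X ^ b) * (1 - fps_X ^ c)) *
       (\<Sum>\<^sub>\<infinity>j | j \<notin> {- k..k - 1}. theta_term A B k j)"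

definition gamma_coeff :: "nat \<Rightarrow> nat \<Rightarrow> nat \<Rightarrow> rat \<Rightarrow> rat \<Rightarrow> int \<Rightarrow> nat \<Rightarrow> rat" where
  "gamma_coeff a b c A B k n = fps_nth (gamma_fps a b c A B k) n"

lemma power_int_minus_one_fps:
  "((- 1) powi i :: rat fps) = fps_const (if even i then 1 else - 1)"
proof -
  have "inverse (- 1 :: rat fps) = - 1"
    by (metis fps_const_1_eq_1 fps_const_neg fps_const_inverse inverse_minus_eq inverse_1)
  then show ?thesis
    by (auto simp: power_int_def minus_one_power_iff even_nat_iff simp flip: fps_const_neg)
qed

lemma summable_theta_term:
  assumes "A > 0"
  shows "theta_term A B k summable_on S"
proof -
  let ?e = "\<lambda>j. nat \<lfloor>A * of_int j ^ 2 + B * of_int j\<rfloor>"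
  have "finite {j \<in> S. fps_nth (theta_term A B k j) n \<noteq> 0}" for n
  proof (rule finite_subset)
    let ?N = "\<lceil>(of_nat n + 1 + \<bar>B\<bar>) / A\<rceil>"
    show "{j \<in> S. fps_nth (theta_term A B k j) n \<noteq> 0} \<subseteq> {- ?N..?N}"
    proof safe
      fix j assume "fps_nth (theta_term A B k j) n \<noteq> 0"
      then have "?e j = n"
        by (auto simp: theta_term_def power_int_minus_one_fps split: if_splits)
      then have "\<lfloor>A * of_int j ^ 2 + B * of_int j\<rfloor> < int n + 1"
        by linarith
      then have less: "A * of_int j ^ 2 + B * of_int j < of_nat n + 1"
        unfolding floor_less_iff by simp
      define x :: rat where "x = \<bar>of_int j\<bar>"
      have "x * x = of_int j ^ 2"
        by (simp add: x_def power2_eq_square flip: of_int_mult)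
      then have "x * (A * x - \<bar>B\<bar>) = A * of_int j ^ 2 - \<bar>B * of_int j\<bar>"
        by (simp add: right_diff_distrib abs_mult mult.left_commute mult.commute x_def)
      then have "x * (A * x - \<bar>B\<bar>) \<le> A * of_int j ^ 2 + B * of_int j"
        by linarith
      with less have *: "x * (A * x - \<bar>B\<bar>) < of_nat n + 1"
        by linarith
      have "A * x - \<bar>B\<bar> \<le> of_nat n + 1"
      proof (cases "j = 0 \<or> A * x - \<bar>B\<bar> \<le> 0")
        case True
        then show ?thesis
          by (auto simp: x_def)
      next
        case False
        then have "1 \<le> \<bar>j\<bar>"
          by linarith
        then have "1 \<le> x"
          unfolding x_def by (metis of_int_1_le_iff of_int_abs)
        then have "1 * (A * x - \<bar>B\<bar>) \<le> x * (A * x - \<bar>B\<bar>)"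
          using False by (intro mult_right_mono) auto
        with * show ?thesis
          by (metis less_imp_le mult_1 order.strict_trans1)
      qed
      then have "x \<le> (of_nat n + 1 + \<bar>B\<bar>) / A"
        using assms by (simp add: pos_le_divide_eq algebra_simps)
      then have "\<bar>j\<bar> \<le> ?N"
        unfolding x_def by (metis le_of_int_ceiling of_int_abs of_int_le_iff order_trans)
      then show "j \<in> {- ?N..?N}"
        by auto
    qed
  qed auto
  then show ?thesis
    unfolding summable_on_def
    by (intro exI[of _ "Abs_fps (\<lambda>n. \<Sum>j | j \<in> S \<and> fps_nth (theta_term A B k j) n \<noteq> 0.
                                    fps_nth (theta_term A B k j) n)"] has_sum_fpsI) auto
qed

lemma theta_term_five_three:
  "theta_term (5/2) (3/2) k j = (- 1) powi (j + k) * fps_X ^ nat (j * (5 * j + 3) div 2)"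
proof -
  have "even (j * (5 * j + 3))"
    by simp
  then have "(of_int (j * (5 * j + 3) div 2) :: rat) = of_int (j * (5 * j + 3)) / 2"
    by (metis dvd_mult_div_cancel nonzero_mult_div_cancel_left of_int_mult of_int_numeral
        zero_neq_numeral)
  then have "5/2 * of_int j ^ 2 + 3/2 * of_int j = (of_int (j * (5 * j + 3) div 2) :: rat)"
    by (simp add: field_simps power2_eq_square)
  then have "\<lfloor>5/2 * of_int j ^ 2 + 3/2 * of_int j :: rat\<rfloor> = j * (5 * j + 3) div 2"
    by (metis floor_of_int)
  then show ?thesis
    by (simp only: theta_term_def)
qed

lemma five_three_exponent_nonneg: "0 \<le> j * (5 * j + 3) div 2" for j :: int
proof -
  have "0 \<le> j * (5 * j + 3)"
    by (cases "j \<ge> 0") (auto intro: mult_nonpos_nonpos)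
  then show ?thesis
    by (simp add: pos_imp_zdiv_nonneg_iff)
qed

end

theory Submission
  imports Defs
begin

text \<open>
  Write e(m) = m(5m+3)/2. Since e(-m-1) = e(m) + 2m + 1, the terms j = m and j = -m-1 combine, and
  40 times the coefficient of q^n is the alternating sum of (-1)^(m-k) f(m) over k \<le> m \<le> M, where
  f(m) = P(n - e(m)) - P(n - e(m) - 2m - 1), P(z) is 40 times the number of partitions of z into
  parts 1, 4, 5, and M is the last index with e(M) \<le> n. Here P(z) = z^2 + 10z + c(z) with c of
  period 20 and values in [1, 45], so for m < M the summand f(m) differs by at most 44 from
  (2m+1)(2n+9-5m(m+1)). This main term equals H(m) + H(m+1) for H(m) = m(2n+14-5m^2), so the
  alternating sum telescopes to H(k) plus a contribution of the index M, and it beats the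
  accumulated error 44(M-k) as soon as k \<ge> 3, or k = 2 and M \<ge> 6, or k = 1 and M \<ge> 43.
  For k = 1 and 9 \<le> M \<le> 42 the accumulated error, which depends only on M and n mod 20, is in fact
  at least -62, which suffices. The remaining cases have n < e(9) = 216 or n < e(6) = 99.
\<close>

section \<open>Partitions into parts 1, 4 and 5\<close>

text \<open>The table makes (z^2 + 10z + corr z) / 40 the number of partitions of z into parts 1, 4, 5.\<close>

definition corr :: "int \<Rightarrow> int" where
  "corr z = [40, 29, 16, 1, 24, 45, 24, 1, 16, 29, 40, 9, 16, 21, 24, 25, 24, 21, 16, 9] ! nat (z mod 20)"

definition part145 :: "int \<Rightarrow> int" where
  "part145 z = (if z < 0 then 0 else z\<^sup>2 + 10 * z + corr z)"

text \<open>Together with \<open>all_mod_20\<close>, this carries a check on the residues 0 to 19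
  over to shifted values of \<open>corr\<close> at all integers.\<close>

lemma corr_mod_20: "corr (z mod 20 - b) = corr (z - b)" "corr (z mod 20) = corr z"
  by (simp_all add: corr_def mod_simps)

lemma all_mod_20:
  fixes z :: int
  assumes "\<forall>r\<in>set [0..19]. P r"
  shows "P (z mod 20)"
  using assms by simp

lemma corr_bounds: "1 \<le> corr z" "corr z \<le> 45"
proof -
  have "\<forall>r\<in>set [0..19]. 1 \<le> corr r \<and> corr r \<le> 45" by code_simp
  from all_mod_20[OF this, of z] show "1 \<le> corr z" "corr z \<le> 45"
    by (simp_all add: corr_mod_20)
qed

lemma corr_diff_1: "- 31 \<le> corr z - corr (z - 1)"
proof -
  have "\<forall>r\<in>set [0..19]. - 31 \<le> corr r - corr (r - 1)" by code_simp
  from all_mod_20[OF this, of z] show ?thesis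
    by (simp add: corr_mod_20)
qed

text \<open>The shifts and signs are those of (1 - x)(1 - x^4)(1 - x^5) = 1 - x - x^4 + x^6 + x^9 -
  x^10.\<close>

lemma corr_recurrence:
  "corr z - corr (z - 1) - corr (z - 4) + corr (z - 6) + corr (z - 9) - corr (z - 10) = 0"
proof -
  have "\<forall>r\<in>set [0..19]. corr r - corr (r - 1) - corr (r - 4) + corr (r - 6) + corr (r - 9) - corr (r - 10) = 0"
    by code_simp
  from all_mod_20[OF this, of z] show ?thesis
    by (simp add: corr_mod_20)
qed

text \<open>The quadratic formula vanishes at -9, ..., -1 and so stays valid a little below 0. This
  absorbs the boundary cases of the recurrence and of \<open>pair_coeff_eq\<close>.\<close>

lemma part145_eq:
  assumes "- 9 \<le> z"
  shows "part145 z = z\<^sup>2 + 10 * z + corr z"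
proof (cases "z < 0")
  case True
  with assms have "z \<in> set [-9..-1]" by simp
  moreover have "\<forall>z\<in>set [-9..-1]. z\<^sup>2 + 10 * z + corr z = 0" by code_simp
  ultimately show ?thesis using True by (simp add: part145_def)
qed (simp add: part145_def)

text \<open>For z > 0 every argument is at least -9, so the quadratic formula applies throughout;
  the polynomial (1 - x)(1 - x^4)(1 - x^5) is divisible by (1 - x)^3 and hence annihilates the
  quadratic part.\<close>

lemma part145_recurrence:
  "part145 z - part145 (z - 1) - part145 (z - 4) + part145 (z - 6) + part145 (z - 9) - part145 (z - 10)
     = (if z = 0 then 40 else 0)"
proof -
  consider "z < 0" | "z = 0" | "z > 0" by linarith
  then show ?thesis
  proof cases
    case 3
    then show ?thesis
      using corr_recurrence[of z]
      by (simp add: part145_eq power2_eq_square algebra_simps)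
  qed (auto simp: part145_def corr_def)
qed

text \<open>For z > 11 the quadratic part grows by 2z + 9 >= 33, while \<open>corr\<close> drops by
  at most 31. The values up to 11 are evaluated.\<close>

lemma part145_mono: "part145 (z - 1) \<le> part145 z"
proof (cases "z \<le> 11")
  case True
  have "\<forall>z\<in>set [-1..11]. part145 (z - 1) \<le> part145 z" by code_simp
  then have "part145 (z - 1) \<le> part145 z" if "z \<in> set [-1..11]"
    using that by (rule bspec)
  moreover have "part145 (z - 1) \<le> part145 z" if "z < 0"
    using that by (simp add: part145_def)
  ultimately show ?thesis using True by fastforce
next
  case False
  then show ?thesis
    using corr_diff_1[of z] by (simp add: part145_def power2_eq_square algebra_simps)
qed

lemma fps_inverse_145:
  "1 / ((1 - fps_X) * (1 - fps_X ^ 4) * (1 - fps_X ^ 5)) = Abs_fps (\<lambda>n. of_int (part145 (int n)) / 40 :: rat)"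
  (is "1 / ?D = ?P")
proof -
  have D: "?D = 1 - fps_X - fps_X ^ 4 + fps_X ^ 6 + fps_X ^ 9 - fps_X ^ 10"
    by (simp add: algebra_simps flip: power_Suc power_add)
  \<comment> \<open>Negative arguments give 0, so multiplication by a power of X is a plain shift of
    the argument.\<close>
  have *: "fps_nth (fps_X ^ b * ?P) n = of_int (part145 (int n - int b)) / 40" for b n
    by (auto simp: fps_X_power_mult_nth part145_def of_nat_diff)
  have "?D * ?P = 1"
  proof (rule fps_ext)
    fix n
    have "?D * ?P = ?P - fps_X ^ 1 * ?P - fps_X ^ 4 * ?P + fps_X ^ 6 * ?P + fps_X ^ 9 * ?P - fps_X ^ 10 * ?P"
      unfolding D power_one_right by (simp only: ring_distribs mult_1)
    then have "fps_nth (?D * ?P) n = of_int (part145 (int n) - part145 (int n - 1) - part145 (int n - 4)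
        + part145 (int n - 6) + part145 (int n - 9) - part145 (int n - 10)) / 40"
      by (simp only: fps_add_nth fps_sub_nth *) (simp add: field_simps)
    also have "\<dots> = fps_nth 1 n"
      unfolding part145_recurrence by simp
    finally show "fps_nth (?D * ?P) n = fps_nth 1 n" .
  qed
  moreover then have "?D \<noteq> 0" by auto
  ultimately show ?thesis
    by (metis nonzero_mult_div_cancel_left)
qed

section \<open>Exponents and the coefficient as a finite sum\<close>

definition expo :: "int \<Rightarrow> int" where
  "expo m = m * (5 * m + 3) div 2"

lemma expo_double: "2 * expo m = m * (5 * m + 3)"
  by (simp add: expo_def)

lemma expo_reflect: "expo (- m - 1) = expo m + 2 * m + 1"
proof -
  have "2 * expo (- m - 1) = 2 * (expo m + 2 * m + 1)"
    unfolding distrib_left expo_double by (simp add: algebra_simps)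
  then show ?thesis by simp
qed

lemma expo_mono:
  assumes "0 \<le> a" "a \<le> b"
  shows "expo a \<le> expo b"
proof -
  have "a * (5 * a + 3) \<le> b * (5 * b + 3)"
    using assms by (intro mult_mono) auto
  then show ?thesis by (simp flip: expo_double)
qed

lemma le_expo:
  assumes "0 \<le> m" shows "m \<le> expo m"
proof -
  have "m * 2 \<le> m * (5 * m + 3)"
    using assms by (intro mult_left_mono) auto
  then show ?thesis by (simp flip: expo_double)
qed

text \<open>40 times the joint contribution of j = m and j = -m-1 at q^n, up to the sign of j =
  m.\<close>

definition pair_coeff :: "int \<Rightarrow> int \<Rightarrow> int" where
  "pair_coeff n m = part145 (n - expo m) - part145 (n - expo m - (2 * m + 1))"

lemma fps_nth_theta_term:
  "fps_nth (theta_term (5/2) (3/2) k j) i = (if int i = expo j then if even (j + k) then 1 else - 1 else 0)"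
  using five_three_exponent_nonneg[of j]
  by (auto simp: theta_term_five_three power_int_minus_one_fps expo_def)

text \<open>Every index of the series outside \<open>F\<close> has an exponent above n, so a finite
  sum replaces the infinite one. N may exceed the last relevant index, since the extra pairs
  contribute 0.\<close>

lemma gamma_coeff_eq:
  fixes k :: int
  assumes "0 \<le> k" "0 \<le> N" "int n < expo (N + 1)"
  shows "gamma_coeff 1 4 5 (5/2) (3/2) k n =
    of_int (\<Sum>m\<in>{k..N}. (if even (m + k) then 1 else - 1) * pair_coeff (int n) m) / 40"
proof -
  let ?t = "theta_term (5/2) (3/2) k" 
  define A where "A = {j. j \<notin> {- k..k - 1}}"
  define F where "F = {k..N} \<union> (\<lambda>m. - m - 1) ` {k..N}"
  let ?P = "Abs_fps (\<lambda>n. of_int (part145 (int n)) / 40 :: rat)"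
  let ?s = "\<lambda>m. if even (m + k) then 1 else - 1 :: int"
  have sm: "?t summable_on A" by (rule summable_theta_term) simp
  then have hs: "(?t has_sum infsum ?t A) A" by simp
  have inf_nth: "fps_nth (infsum ?t A) i = fps_nth (sum ?t F) i" if "i \<le> n" for i
  proof -
    have "j \<in> F" if j: "j \<in> A" "int i = expo j" for j
    proof (cases "j \<ge> 0")
      case True
      with j assms \<open>i \<le> n\<close> have "j \<le> N"
        using expo_mono[of "N + 1" j] by linarith
      with True j show ?thesis by (auto simp: A_def F_def)
    next
      case False
      with j assms \<open>i \<le> n\<close> have "- j - 1 \<le> N"
        using expo_mono[of "N + 1" "- j - 1"] expo_reflect[of j] by linarith
      with False j have "- j - 1 \<in> {k..N}" by (auto simp: A_def)
      then have "- (- j - 1) - 1 \<in> F" unfolding F_def by blast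
      then show ?thesis by simp
    qed
    then have "{j \<in> A. fps_nth (?t j) i \<noteq> 0} \<subseteq> F"
      by (auto simp: fps_nth_theta_term split: if_splits)
    moreover have "finite F" "F \<subseteq> A"
      using assms(1) by (auto simp: F_def A_def)
    ultimately have "(\<Sum>j | j \<in> A \<and> fps_nth (?t j) i \<noteq> 0. fps_nth (?t j) i) = (\<Sum>j\<in>F. fps_nth (?t j) i)"
      by (intro sum.mono_neutral_left) auto
    then show ?thesis
      by (simp add: has_sum_fpsD(2)[OF hs] fps_sum_nth)
  qed
  have term_nth: "fps_nth (?P * ?t j) n = of_int ((if even (j + k) then 1 else - 1) * part145 (int n - expo j)) / 40" for j
  proof -
    obtain b where b: "expo j = int b"
      using five_three_exponent_nonneg[of j] by (metis expo_def nonneg_int_cases)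
    have "?P * ?t j = fps_const (if even (j + k) then 1 else - 1) * (fps_X ^ b * ?P)"
      using b by (simp add: theta_term_five_three power_int_minus_one_fps expo_def)
    moreover have "fps_nth (fps_X ^ b * ?P) n = of_int (part145 (int n - int b)) / 40"
      by (auto simp: fps_X_power_mult_nth part145_def of_nat_diff)
    ultimately show ?thesis
      unfolding b by (simp only: fps_mult_left_const_nth) simp
  qed
  have "gamma_coeff 1 4 5 (5/2) (3/2) k n = fps_nth (?P * infsum ?t A) n"
    unfolding gamma_coeff_def gamma_fps_def power_one_right fps_inverse_145 A_def ..
  also have "\<dots> = fps_nth (?P * sum ?t F) n"
    unfolding fps_mult_nth by (intro sum.cong arg_cong2[of _ _ _ _ "(*)"] refl inf_nth) auto
  also have "\<dots> = (\<Sum>j\<in>F. of_int ((if even (j + k) then 1 else - 1) * part145 (int n - expo j)) / 40)"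
    unfolding sum_distrib_left fps_sum_nth term_nth ..
  also have "\<dots> = of_int (\<Sum>j\<in>F. (if even (j + k) then 1 else - 1) * part145 (int n - expo j)) / 40"
    by (simp add: sum_divide_distrib)
  also have "(\<Sum>j\<in>F. (if even (j + k) then 1 else - 1) * part145 (int n - expo j)) =
     (\<Sum>m\<in>{k..N}. ?s m * part145 (int n - expo m)) +
     (\<Sum>m\<in>{k..N}. ?s (- m - 1) * part145 (int n - expo (- m - 1)))"
    unfolding F_def using assms(1) by (subst sum.union_disjoint) (auto simp: sum.reindex inj_on_def)
  also have "\<dots> = (\<Sum>m\<in>{k..N}. ?s m * pair_coeff (int n) m)"
    \<comment> \<open>The parities of m and -m-1 differ, so the reflected term enters with the
      opposite sign.\<close>
    unfolding sum.distrib[symmetric] expo_reflect pair_coeff_def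
    by (intro sum.cong refl) (auto simp: algebra_simps)
  finally show ?thesis .
qed

section \<open>Main term, error term and telescoping\<close>

lemma expo_Suc: "expo (m + 1) = expo m + 5 * m + 4"
proof -
  have "2 * expo (m + 1) = 2 * expo m + 10 * m + 8"
    unfolding expo_double by (simp add: algebra_simps)
  then show ?thesis by simp
qed

definition pair_main :: "int \<Rightarrow> int \<Rightarrow> int" where
  "pair_main n m = (2 * m + 1) * (2 * n + 9 - 5 * m * (m + 1))"

definition main_half :: "int \<Rightarrow> int \<Rightarrow> int" where
  "main_half n m = m * (2 * n + 14 - 5 * m\<^sup>2)"

definition pair_err :: "int \<Rightarrow> int \<Rightarrow> int" where
  "pair_err n m = corr (n - expo m) - corr (n - (expo m + 2 * m + 1))"

lemma pair_main_eq: "pair_main n m = main_half n m + main_half n (m + 1)"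
  by (simp add: pair_main_def main_half_def power2_eq_square algebra_simps)

lemma alternating_sum_pair_main:
  "(\<Sum>i<d. (- 1) ^ i * pair_main n (k + int i)) = main_half n k - (- 1) ^ d * main_half n (k + int d)"
  by (induction d) (simp_all add: pair_main_eq algebra_simps)

text \<open>The second hypothesis says that the smaller argument n - expo m - 2m - 1 is at least -9,
  the limit in \<open>part145_eq\<close>.\<close>

lemma pair_coeff_eq:
  assumes "0 \<le> m" "expo m + 2 * m \<le> n + 8"
  shows "pair_coeff n m = pair_main n m + pair_err n m"
proof -
  define w where "w = n - expo m"
  have w: "2 * n = 2 * w + m * (5 * m + 3)"
    by (simp add: w_def flip: expo_double)
  have "pair_main n m = (2 * m + 1) * (2 * w - (2 * m + 1) + 10)"
    unfolding pair_main_def w by (simp add: algebra_simps)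
  then have "pair_main n m = w\<^sup>2 + 10 * w - ((w - (2 * m + 1))\<^sup>2 + 10 * (w - (2 * m + 1)))"
    by (simp add: power2_eq_square algebra_simps)
  moreover have "pair_coeff n m = w\<^sup>2 + 10 * w + corr w -
      ((w - (2 * m + 1))\<^sup>2 + 10 * (w - (2 * m + 1)) + corr (w - (2 * m + 1)))"
    using assms by (simp add: pair_coeff_def part145_eq w_def)
  moreover have "pair_err n m = corr w - corr (w - (2 * m + 1))"
    by (simp add: pair_err_def w_def diff_diff_eq add.assoc)
  ultimately show ?thesis by simp
qed

lemma abs_pair_err: "\<bar>pair_err n m\<bar> \<le> 44"
  using corr_bounds[of "n - expo m"] corr_bounds[of "n - (expo m + 2 * m + 1)"]
  unfolding pair_err_def by linarith

lemma alternating_sum_pair_err_ge: "(\<Sum>i<d. (- 1) ^ i * pair_err n (k + int i)) \<ge> - 44 * int d"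
proof (induction d)
  case (Suc d)
  have "\<bar>(- 1) ^ d * pair_err n (k + int d)\<bar> \<le> 44"
    using abs_pair_err[of n "k + int d"] by (simp add: abs_mult)
  with Suc show ?case by simp
qed simp

lemma signed_sum_eq_alternating:
  fixes f :: "int \<Rightarrow> int"
  shows "(\<Sum>m\<in>{k..k + int d}. (if even (m + k) then 1 else - 1) * f m) = (\<Sum>i\<le>d. (- 1) ^ i * f (k + int i))"
proof -
  have "{k..k + int d} = (\<lambda>i. k + int i) ` {..d}"
  proof safe
    fix m assume "m \<in> {k..k + int d}"
    then have "m = k + int (nat (m - k))" "nat (m - k) \<le> d" by auto
    then show "m \<in> (\<lambda>i. k + int i) ` {..d}" by blast
  qed auto
  then show ?thesis
    by (auto simp: sum.reindex inj_on_def minus_one_power_iff intro!: sum.cong)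
qed

text \<open>\<open>part145\<close> is monotone. This settles the sums that consist of a single
  pair.\<close>

lemma pair_coeff_nonneg:
  assumes "0 \<le> m" shows "0 \<le> pair_coeff n m"
proof -
  have "part145 (z - int i) \<le> part145 z" for z i
  proof (induction i)
    case (Suc i)
    then show ?case using part145_mono[of "z - int i"] by (simp add: algebra_simps)
  qed simp
  from this[of "n - expo m" "nat (2 * m + 1)"] show ?thesis
    using assms by (simp add: pair_coeff_def)
qed

text \<open>For a pair before the last, n >= expo (m + 1) = expo m + 5m + 4 puts both arguments in
  the range of the quadratic formula. The boundary term of the telescoped sum is grouped with the
  last pair.\<close>

lemma alternating_sum_pair_coeff:
  assumes "0 \<le> k" "expo (k + int d) \<le> n"
  shows "(\<Sum>i\<le>d. (- 1) ^ i * pair_coeff n (k + int i)) =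
    main_half n k + (\<Sum>i<d. (- 1) ^ i * pair_err n (k + int i)) +
    (- 1) ^ d * (pair_coeff n (k + int d) - main_half n (k + int d))"
proof -
  have "pair_coeff n (k + int i) = pair_main n (k + int i) + pair_err n (k + int i)" if "i < d" for i
  proof (rule pair_coeff_eq)
    define m where "m = k + int i"
    have "expo (m + 1) \<le> expo (k + int d)"
      using that assms by (intro expo_mono) (auto simp: m_def)
    then have "expo m + 5 * m + 4 \<le> n"
      using assms expo_Suc[of m] by linarith
    moreover have "0 \<le> m" using assms by (simp add: m_def)
    ultimately show "expo (k + int i) + 2 * (k + int i) \<le> n + 8"
      unfolding m_def[symmetric] by linarith
  qed (use assms in auto)
  then have "(\<Sum>i<d. (- 1) ^ i * pair_coeff n (k + int i)) =
      (\<Sum>i<d. (- 1) ^ i * pair_main n (k + int i)) + (\<Sum>i<d. (- 1) ^ i * pair_err n (k + int i))"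
    by (simp add: distrib_left sum.distrib)
  then show ?thesis
    unfolding alternating_sum_pair_main by (simp add: lessThan_Suc_atMost[symmetric] algebra_simps)
qed

section \<open>Contribution of the last pair\<close>

text \<open>
  The main-term formula fails for the last pair if n < e(M) + 2M - 8, since then n - e(M) - 2M - 1
  lies below the range of validity of the formula for P; the proof splits at n - e(M) = 2M.
\<close>

lemma last_pair_bound:
  fixes d :: nat
  assumes "1 \<le> k" "M = k + int d" "1 \<le> d" "expo M \<le> n" "n < expo (M + 1)" "M \<ge> 9 \<or> k \<ge> 2"
  shows "main_half n k + (- 1) ^ d * (pair_coeff n M - main_half n M) \<ge>
    k * (5 * M\<^sup>2 - 5 * k\<^sup>2 + 3 * M + 14) - 4 * M\<^sup>2 - 2 * M - 35"
proof -
  define z where "z = n - expo M"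
  have n: "2 * n = 5 * M\<^sup>2 + 3 * M + 2 * z"
    using expo_double[of M] by (simp add: z_def power2_eq_square algebra_simps)
  have z: "0 \<le> z" "z \<le> 5 * M + 3" using assms expo_Suc[of M] by (auto simp: z_def)
  have Hk: "main_half n k = k * (5 * M\<^sup>2 - 5 * k\<^sup>2 + 3 * M + 14) + 2 * (k * z)"
    unfolding main_half_def n by (simp add: algebra_simps)
  have HM: "main_half n M = 3 * M\<^sup>2 + 2 * (M * z) + 14 * M"
    unfolding main_half_def n by (simp add: power2_eq_square algebra_simps)
  have M: "k + 1 \<le> M" using assms by simp
  have M3: "3 \<le> M" using M assms(1,6) by auto
  have kz: "z \<le> k * z" using assms z by (simp add: mult_le_cancel_right1)
  show ?thesis
  proof (cases "z \<le> 2 * M")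
    case True
    then have P: "pair_coeff n M = z\<^sup>2 + 10 * z + corr z"
      using z by (simp add: pair_coeff_def part145_def z_def)
    show ?thesis
    proof (cases "even d")
      case True
      \<comment> \<open>The square is completed in z^2 + 12z - 2Mz, where 12z is 10z from
        \<open>part145\<close> plus 2z from 2kz >= 2z. With corr z >= 1 the constant becomes -36 + 1
        = -35, so this case yields exactly the claimed bound.\<close>
      have "0 \<le> (z - M + 6)\<^sup>2" by simp
      then have "z\<^sup>2 + 12 * z - 2 * (M * z) \<ge> 12 * M - 36 - M\<^sup>2"
        by (simp add: power2_eq_square algebra_simps)
      with True kz corr_bounds[of z] show ?thesis
        unfolding Hk HM P by simp
    next
      case False
      have "z * z \<le> 2 * M * z" using \<open>z \<le> 2 * M\<close> z by (intro mult_right_mono) auto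
      then have "z * z \<le> 2 * (M * z)" by (simp add: mult.assoc)
      moreover have "3 * 3 \<le> M * M" using M3 by (intro mult_mono) auto
      moreover have "(- 1) ^ d = (- 1 :: int)" using False by simp
      ultimately show ?thesis
        using kz corr_bounds(2)[of z] z \<open>z \<le> 2 * M\<close> M3
        unfolding Hk HM P power2_eq_square by simp
    qed
  next
    case False
    then have "pair_coeff n M = pair_main n M + pair_err n M"
      using M assms by (intro pair_coeff_eq) (auto simp: z_def)
    \<comment> \<open>The product is \<open>main_half n (M + 1)\<close> expressed through z.\<close>
    moreover have "pair_main n M = main_half n M + (M + 1) * (2 * z - 7 * M + 9)"
      unfolding pair_main_def main_half_def n by (simp add: power2_eq_square algebra_simps)
    ultimately have P: "pair_coeff n M - main_half n M = (M + 1) * (2 * z - 7 * M + 9) + pair_err n M"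
      by simp
    have err: "\<bar>pair_err n M\<bar> \<le> 44" by (rule abs_pair_err)
    show ?thesis
    proof (cases "even d")
      case True
      have "(M + 1) * (11 - 3 * M) \<le> (M + 1) * (2 * z - 7 * M + 9)"
        using False M3 by (intro mult_left_mono) auto
      then have "8 * M + 11 - 3 * M\<^sup>2 \<le> (M + 1) * (2 * z - 7 * M + 9)"
        by (simp add: power2_eq_square algebra_simps)
      moreover have sign: "(- 1) ^ d = (1 :: int)" and "0 \<le> M\<^sup>2" using True by simp_all
      ultimately show ?thesis
        using kz err False M3 unfolding Hk P sign mult_1 by linarith
    next
      case odd: False
      \<comment> \<open>For odd d the expression decreases in z because k <= M, so the largest value
        z = 5M + 3 is the worst.\<close>
      have "(M + 1 - k) * z \<le> (M + 1 - k) * (5 * M + 3)"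
        using M z by (intro mult_left_mono) auto
      then have "2 * (k * z) - (M + 1) * (2 * z - 7 * M + 9) \<ge> 
          2 * (k * (5 * M + 3)) - (M + 1) * (3 * M + 15)"
        by (simp add: algebra_simps)
      moreover have "2 * (k * (5 * M + 3)) - (M + 1) * (3 * M + 15) - 44 \<ge> - 4 * M\<^sup>2 - 2 * M - 35"
      proof (cases "k \<ge> 2")
        case True
        have "2 * (5 * M + 3) \<le> k * (5 * M + 3)" using M assms True by (intro mult_right_mono) auto
        moreover have "3 * 3 \<le> M * M" using M3 by (intro mult_mono) auto
        ultimately show ?thesis using M3 by (simp add: power2_eq_square algebra_simps)
      next
        case False
        \<comment> \<open>What remains for k = 1 is M^2 - 6M - 18 >= 0. It fails at M = 8, whence
          the threshold 9.\<close>
        then have "k = 1" "M \<ge> 9" using assms by auto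
        moreover have "0 \<le> (M - 9)\<^sup>2" by simp
        ultimately show ?thesis by (simp add: power2_eq_square algebra_simps)
      qed
      ultimately show ?thesis
        using odd err unfolding Hk P by simp
    qed
  qed
qed

section \<open>Passage to the last index, and finite checks by evaluation\<close>

lemma gamma_coeff_eq_alternating:
  assumes "0 \<le> k" "int n < expo (k + int d + 1)"
  shows "gamma_coeff 1 4 5 (5/2) (3/2) k n = of_int (\<Sum>i\<le>d. (- 1) ^ i * pair_coeff (int n) (k + int i)) / 40"
  unfolding signed_sum_eq_alternating[symmetric] using assms by (intro gamma_coeff_eq) auto

lemma gamma_coeff_nonnegI:
  assumes "0 \<le> k" "int n < expo (k + int d + 1)"
    and "0 \<le> (\<Sum>i\<le>d. (- 1) ^ i * pair_coeff (int n) (k + int i))"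
  shows "0 \<le> gamma_coeff 1 4 5 (5/2) (3/2) k n"
  unfolding gamma_coeff_eq_alternating[OF assms(1,2)] using assms(3)
  by (intro divide_nonneg_pos) (simp_all only: of_int_0_le_iff zero_less_numeral)

lemma gamma_coeff_below:
  assumes "0 \<le> k" "int n < expo k"
  shows "gamma_coeff 1 4 5 (5/2) (3/2) k n = 0"
proof -
  have "expo k \<le> expo (k + 1)" using assms by (intro expo_mono) auto
  moreover have "pair_coeff (int n) k = 0"
    using assms by (simp add: pair_coeff_def part145_def)
  ultimately show ?thesis
    using assms gamma_coeff_eq_alternating[of k n 0] by simp
qed

lemma last_index_exists:
  assumes "0 \<le> k" "expo k \<le> int n"
  obtains d where "expo (k + int d) \<le> int n" "int n < expo (k + int d + 1)"
proof -
  let ?P = "\<lambda>d. int n < expo (k + int d + 1)"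
  have "?P n" using le_expo[of "k + int n + 1"] assms by linarith
  then have *: "?P (Least ?P)" by (rule LeastI)
  show thesis
  proof (cases "Least ?P")
    case 0
    then show ?thesis using that[of 0] assms * by simp
  next
    case (Suc d)
    then have "\<not> ?P d" using not_less_Least[of d ?P] by simp
    then show ?thesis using that[of "Suc d"] * Suc by (simp add: algebra_simps)
  qed
qed

text \<open>A list version of the sum, which \<open>code_simp\<close> can evaluate.\<close>

definition alternating_pairs :: "int \<Rightarrow> int \<Rightarrow> nat \<Rightarrow> int" where
  "alternating_pairs n k d = sum_list (map (\<lambda>i. (- 1) ^ i * pair_coeff n (k + int i)) [0..<Suc d])"

lemma alternating_pairs_eq: "alternating_pairs n k d = (\<Sum>i\<le>d. (- 1) ^ i * pair_coeff n (k + int i))"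
  unfolding alternating_pairs_def interv_sum_list_conv_sum_set_nat
  by (simp add: lessThan_Suc_atMost atLeast0LessThan del: upt_Suc)

text \<open>Here 216 = expo 9, and the pairs 1 to 8 are summed. Pairs that start above n vanish, so
  one length serves all n.\<close>

lemma small_cases_1: "\<forall>n\<in>set [0..215]. 0 \<le> alternating_pairs n 1 7"
  by code_simp

text \<open>Likewise 99 = expo 6, with the pairs 2 to 5.\<close>

lemma small_cases_2: "\<forall>n\<in>set [0..98]. 0 \<le> alternating_pairs n 2 3"
  by code_simp

text \<open>Tests every prefix of an alternating error sum in one pass: \<open>m\<close> is the next
  index, \<open>s\<close> its sign, \<open>acc\<close> the sum so far.\<close>

fun err_sums_ge :: "int \<Rightarrow> int \<Rightarrow> nat \<Rightarrow> int \<Rightarrow> int \<Rightarrow> int \<Rightarrow> bool" where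
  "err_sums_ge b n 0 m s acc = (b \<le> acc)"
| "err_sums_ge b n (Suc d) m s acc = (b \<le> acc \<and> err_sums_ge b n d (m + 1) (- s) (acc + s * pair_err n m))"

lemma err_sums_geD:
  assumes "err_sums_ge b n d m s acc" "d' \<le> d"
  shows "b \<le> acc + s * (\<Sum>i<d'. (- 1) ^ i * pair_err n (m + int i))"
  using assms
proof (induction d arbitrary: d' m s acc)
  case (Suc d)
  show ?case
  proof (cases d')
    case 0
    then show ?thesis using Suc.prems by simp
  next
    case (Suc e)
    then have "b \<le> acc + s * pair_err n m + - s * (\<Sum>i<e. (- 1) ^ i * pair_err n (m + 1 + int i))"
      using Suc.prems by (intro Suc.IH) auto
    then show ?thesis
      unfolding Suc sum.lessThan_Suc_shift
      by (simp add: algebra_simps sum_negf)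
  qed
qed simp

lemma err_sums_check: "\<forall>r\<in>set [0..19]. err_sums_ge (- 62) r 41 1 1 0"
  by code_simp

text \<open>\<open>pair_err\<close> depends on n only modulo 20, so 20 evaluations cover all n. In
  this range the general bound -44d is too weak for k = 1.\<close>

lemma err_sum_ge:
  assumes "d \<le> 41"
  shows "- 62 \<le> (\<Sum>i<d. (- 1) ^ i * pair_err n (1 + int i))"
proof -
  have "err_sums_ge (- 62) (n mod 20) 41 1 1 0"
    using all_mod_20[OF err_sums_check] .
  from err_sums_geD[OF this assms] show ?thesis
    by (simp add: pair_err_def corr_mod_20)
qed

section \<open>Combination of main term and error\<close>

text \<open>After telescoping and \<open>last_pair_bound\<close>, a polynomial in k and M has to
  absorb the error sum. With M = k + d, the thresholds on d mean M >= 9 for k = 1 and M >= 6 for k =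
  2.\<close>

lemma gamma_nonneg_main:
  fixes k :: int and n d :: nat
  assumes k: "1 \<le> k" and d: "expo (k + int d) \<le> int n" "int n < expo (k + int d + 1)"
    and large: "k = 1 \<longrightarrow> 8 \<le> d" "k = 2 \<longrightarrow> 4 \<le> d"
  shows "0 \<le> (\<Sum>i\<le>d. (- 1) ^ i * pair_coeff (int n) (k + int i))"
proof (cases "d = 0")
  case True
  then show ?thesis using pair_coeff_nonneg[of k] k by simp
next
  case False
  define E where "E = (\<Sum>i<d. (- 1) ^ i * pair_err (int n) (k + int i))"
  define M where "M = k + int d"
  have E: "- 44 * int d \<le> E"
    unfolding E_def by (rule alternating_sum_pair_err_ge)
  have "k * (5 * M\<^sup>2 - 5 * k\<^sup>2 + 3 * M + 14) - 4 * M\<^sup>2 - 2 * M - 35 + E \<ge> 0"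
  proof -
    consider "k = 1" "d \<le> 41" | "k = 1" "42 \<le> d" | "k = 2" | "3 \<le> k"
      using k by linarith
    then show ?thesis
    proof cases
      case 1
      then have "- 62 \<le> E" unfolding E_def by (simp add: err_sum_ge)
      \<comment> \<open>For k = 1 the polynomial is M^2 + M - 26, which is at least 64 here.\<close>
      moreover have "9 * 10 \<le> M * (M + 1)"
        using 1 large by (intro mult_mono) (auto simp: M_def)
      ultimately show ?thesis using 1
        by (simp add: power2_eq_square algebra_simps)
    next
      case 2
      \<comment> \<open>The total is M^2 + M - 26 - 44(M - 1) = M(M - 43) + 18.\<close>
      then have "43 * M \<le> M * M"
        by (intro mult_right_mono) (auto simp: M_def)
      moreover have "int d = M - 1" using 2 by (simp add: M_def)
      ultimately show ?thesis using E
        unfolding 2(1) mult_1 power2_eq_square by linarith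
    next
      case 3
      \<comment> \<open>The total is 6M^2 - 40M + 41 = 6(M - 6)^2 + 32(M - 6) + 17.\<close>
      have "0 \<le> (M - 6)\<^sup>2" by simp
      moreover have "int d = M - 2" "6 \<le> M" using 3 large by (simp_all add: M_def)
      ultimately show ?thesis using E
        unfolding 3 by (simp add: power2_eq_square algebra_simps)
    next
      case 4
      \<comment> \<open>In the variables a, b >= 0 all coefficients are nonnegative, and 76 + 44b
        covers the error 44d = 44b + 44.\<close>
      define a b where "a = k - 3" and "b = int d - 1"
      have ab: "0 \<le> a" "0 \<le> b" using 4 False by (simp_all add: a_def b_def)
      have kM: "k = a + 3" "M = a + b + 4" "int d = b + 1" by (simp_all add: a_def b_def M_def)
      define p where "p = 9 * (a * a) + 11 * (b * b) + 5 * (a * (b * b)) + 10 * (a * (a * b)) +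
          65 * (a * b) + 66 * a + 51 * b"
      have "0 \<le> p"
        unfolding p_def using ab by (intro add_nonneg_nonneg) simp_all
      moreover have "k * (5 * M\<^sup>2 - 5 * k\<^sup>2 + 3 * M + 14) - 4 * M\<^sup>2 - 2 * M - 35 = 76 + 44 * b + p"
        unfolding kM p_def by (simp add: power2_eq_square algebra_simps)
      ultimately show ?thesis using E kM(3) by linarith
    qed
  qed
  moreover have "main_half (int n) k + (- 1) ^ d * (pair_coeff (int n) M - main_half (int n) M) \<ge>
      k * (5 * M\<^sup>2 - 5 * k\<^sup>2 + 3 * M + 14) - 4 * M\<^sup>2 - 2 * M - 35"
    using k d large False by (intro last_pair_bound) (auto simp: M_def)
  ultimately show ?thesis
    using alternating_sum_pair_coeff[of k d "int n"] k d unfolding E_def M_def by simp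
qed

theorem corollary2p6:
  fixes k :: int and n :: nat
  assumes "k \<ge> 1"
  shows "gamma_coeff 1 4 5 (5/2) (3/2) k n \<ge> 0"
proof (cases "int n < expo k")
  case True
  then show ?thesis using assms by (simp add: gamma_coeff_below del: One_nat_def)
next
  case False
  then obtain d where d: "expo (k + int d) \<le> int n" "int n < expo (k + int d + 1)"
    using last_index_exists[of k n] assms by auto
  \<comment> \<open>In the first two cases n lies below expo 9 = 216 or expo 6 = 99, the ranges
    checked by evaluation.\<close>
  consider "k = 1" "d < 8" | "k = 2" "d < 4" | "k = 1 \<longrightarrow> 8 \<le> d" "k = 2 \<longrightarrow> 4 \<le> d"
    by linarith
  then show ?thesis
  proof cases
    case 1
    then have "expo (k + int d + 1) \<le> expo 9" by (intro expo_mono) auto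
    then have n: "int n < 216" using d by (simp add: expo_def)
    then have "0 \<le> alternating_pairs (int n) 1 7"
      by (intro bspec[OF small_cases_1]) simp
    then show ?thesis
      unfolding 1 alternating_pairs_eq using n by (intro gamma_coeff_nonnegI[of 1 n 7]) (auto simp: expo_def)
  next
    case 2
    then have "expo (k + int d + 1) \<le> expo 6" by (intro expo_mono) auto
    then have n: "int n < 99" using d by (simp add: expo_def)
    then have "0 \<le> alternating_pairs (int n) 2 3"
      by (intro bspec[OF small_cases_2]) simp
    then show ?thesis
      unfolding 2 alternating_pairs_eq using n by (intro gamma_coeff_nonnegI[of 2 n 3]) (auto simp: expo_def)
  next
    case 3
    then have "0 \<le> (\<Sum>i\<le>d. (- 1) ^ i * pair_coeff (int n) (k + int i))"
      using assms d by (intro gamma_nonneg_main) auto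
    then show ?thesis
      using assms d by (intro gamma_coeff_nonnegI[of k n d]) auto
  qed
qed

end
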